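(* Let $H$ be a graph with $o(H)=\mathcal{D}$ and let $G$ be a connected graph with $n(G)\geq 2$. Then $$\left\lceil \tfrac{n(G)}{2}\right\rceil+\left\lfloor \tfrac{n(G)}{2}\right\rfloor\gamma_{\mathrm{MB}}(H)\le \gamma_{\mathrm{MB}}(G\odot H)\le \left\lceil \tfrac{n(G)}{2}\right\rceil+\left\lfloor \tfrac{n(G)}{2}\right\rfloor\gamma_{\mathrm{MB}}'(H)$$ and $$\left\lfloor \tfrac{n(G)}{2}\right\rfloor+\left\lceil \tfrac{n(G)}{2}\right\rceil\gamma_{\mathrm{MB}}(H)\le \gamma_{\mathrm{MB}}'(G\odot H)\le \left\lfloor \tfrac{n(G)}{2}\right\rfloor+\left\lceil \tfrac{n(G)}{2}\right\rceil\gamma_{\mathrm{MB}}'(H).$$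
   Context: All graphs are finite and simple; $n(G)$ denotes the order of $G$. The Maker-Breaker domination game on a graph $G$: Dominator and Staller alternately select a not yet selected vertex of $G$. Dominator wins if his selected vertices contain a dominating set of $G$; Staller wins if she selects at least one vertex from every dominating set of $G$. In the D-game Dominator moves first, in the S-game Staller moves first. $\gamma_{\mathrm{MB}}(G)$ (resp. $\gamma_{\mathrm{MB}}'(G)$) is the minimum number of moves Dominator needs to win the D-game (resp. S-game) on $G$ when both players play optimally, and is $\infty$ if Dominator has no winning strategy. The outcome $o(G)=\mathcal{D}$ means Dominator has a winning strategy in both the D-game and the S-game. The corona $G\odot H$ is obtained from one copy of $G$ and $n(G)$ disjoint copies of $H$ by joining the $i$-th vertex of $G$ to every vertex of the $i$-th copy of $H$. *)

theory Defs
  imports Complex_Main "HOL-Library.Extended_Nat" "Graph_Theory.Graph_Theory"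
begin

text \<open>
  Finite simple graphs are the pair graphs of \<^theory>\<open>Graph_Theory.Pair_Digraph\<close>
  (finite, symmetric and loop-free sets of arcs).
\<close>

definition dominating_set :: "'a pair_pre_digraph \<Rightarrow> 'a set \<Rightarrow> bool" where
  "dominating_set G A \<longleftrightarrow>
     A \<subseteq> pverts G \<and> (\<forall>v\<in>pverts G. v \<in> A \<or> (\<exists>u\<in>A. (u, v) \<in> parcs G))"

datatype game = D_game | S_game

text \<open>
  A (partial) play is recorded as the list of the vertices selected so far, oldest first.
  The turn is determined by the number of moves already made.
\<close>

fun dominator_turn :: "game \<Rightarrow> nat \<Rightarrow> bool" where
  "dominator_turn D_game i \<longleftrightarrow> even i"
| "dominator_turn S_game i \<longleftrightarrow> odd i"

definition play :: "'a pair_pre_digraph \<Rightarrow> 'a list \<Rightarrow> bool" where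
  "play G p \<longleftrightarrow> distinct p \<and> set p \<subseteq> pverts G"

definition complete_play :: "'a pair_pre_digraph \<Rightarrow> 'a list \<Rightarrow> bool" where
  "complete_play G p \<longleftrightarrow> distinct p \<and> set p = pverts G"

definition dominator_moves :: "game \<Rightarrow> 'a list \<Rightarrow> 'a list" where
  "dominator_moves g p = nths p {i. dominator_turn g i}"

text \<open>
  A strategy of Dominator maps the history of the game to his next move. Staller's moves are
  unrestricted, so quantifying over all consistent plays means quantifying over all her replies.
\<close>

definition consistent :: "game \<Rightarrow> ('a list \<Rightarrow> 'a) \<Rightarrow> 'a list \<Rightarrow> bool" where
  "consistent g \<sigma> p \<longleftrightarrow> (\<forall>i<length p. dominator_turn g i \<longrightarrow> p ! i = \<sigma> (take i p))"

definition dominator_strategy ::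
    "game \<Rightarrow> 'a pair_pre_digraph \<Rightarrow> ('a list \<Rightarrow> 'a) \<Rightarrow> bool" where
  "dominator_strategy g G \<sigma> \<longleftrightarrow>
     (\<forall>p. play G p \<and> consistent g \<sigma> p \<and> dominator_turn g (length p) \<and> set p \<noteq> pverts G
          \<longrightarrow> \<sigma> p \<in> pverts G - set p)"

definition winning_strategy ::
    "game \<Rightarrow> 'a pair_pre_digraph \<Rightarrow> ('a list \<Rightarrow> 'a) \<Rightarrow> bool" where
  "winning_strategy g G \<sigma> \<longleftrightarrow> dominator_strategy g G \<sigma> \<and>
     (\<forall>p. complete_play G p \<and> consistent g \<sigma> p
          \<longrightarrow> (\<exists>A \<subseteq> set (dominator_moves g p). dominating_set G A))"

text \<open>
  Plays are continued until every vertex has been selected, also after Dominator has won; he has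
  won within his first \<open>k\<close> moves iff these moves contain a dominating set.
\<close>

definition wins_within ::
    "game \<Rightarrow> 'a pair_pre_digraph \<Rightarrow> ('a list \<Rightarrow> 'a) \<Rightarrow> nat \<Rightarrow> bool" where
  "wins_within g G \<sigma> k \<longleftrightarrow> dominator_strategy g G \<sigma> \<and>
     (\<forall>p. complete_play G p \<and> consistent g \<sigma> p
          \<longrightarrow> (\<exists>A \<subseteq> set (take k (dominator_moves g p)). dominating_set G A))"

text \<open>The infimum of the empty set in \<^typ>\<open>enat\<close> is \<open>\<infinity>\<close>.\<close>

definition mb_number :: "game \<Rightarrow> 'a pair_pre_digraph \<Rightarrow> enat" where
  "mb_number g G = Inf {enat k | k. \<exists>\<sigma>. wins_within g G \<sigma> k}"

abbreviation gamma_MB :: "'a pair_pre_digraph \<Rightarrow> enat" where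
  "gamma_MB \<equiv> mb_number D_game"

abbreviation gamma_MB' :: "'a pair_pre_digraph \<Rightarrow> enat" where
  "gamma_MB' \<equiv> mb_number S_game"

definition outcome_D :: "'a pair_pre_digraph \<Rightarrow> bool" where
  "outcome_D G \<longleftrightarrow> (\<exists>\<sigma>. winning_strategy D_game G \<sigma>) \<and> (\<exists>\<sigma>. winning_strategy S_game G \<sigma>)"

text \<open>
  \<open>Inl v\<close> is the vertex \<open>v\<close> of \<open>G\<close>, and \<open>Inr (v, x)\<close> is the vertex \<open>x\<close> in the copy of \<open>H\<close>
  attached to \<open>v\<close>.
\<close>

definition corona ::
    "'a pair_pre_digraph \<Rightarrow> 'b pair_pre_digraph \<Rightarrow> ('a + 'a \<times> 'b) pair_pre_digraph"
    (infixl \<open>\<odot>\<close> 70) where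
  "G \<odot> H = \<lparr>
     pverts = Inl ` pverts G \<union> Inr ` (pverts G \<times> pverts H),
     parcs =
       {(Inl u, Inl v) | u v. (u, v) \<in> parcs G}
       \<union> {(Inr (v, x), Inr (v, y)) | v x y. v \<in> pverts G \<and> (x, y) \<in> parcs H}
       \<union> {(Inl v, Inr (v, x)) | v x. v \<in> pverts G \<and> x \<in> pverts H}
       \<union> {(Inr (v, x), Inl v) | v x. v \<in> pverts G \<and> x \<in> pverts H} \<rparr>"

lemma pair_graph_corona:
  assumes "pair_graph G" and "pair_graph H"
  shows "pair_graph (G \<odot> H)"
proof -
  interpret G: pair_graph G by fact
  interpret H: pair_graph H by fact
  have G1: "u \<in> pverts G" "v \<in> pverts G" "u \<noteq> v" "(v, u) \<in> parcs G" if "(u, v) \<in> parcs G" for u v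
    using that G.arc_fst_in_verts G.arc_snd_in_verts G.pair_no_loops G.pair_sym_arcs
    by (force simp: symmetric_def dest: symD)+
  have H1: "u \<in> pverts H" "v \<in> pverts H" "u \<noteq> v" "(v, u) \<in> parcs H" if "(u, v) \<in> parcs H" for u v
    using that H.arc_fst_in_verts H.arc_snd_in_verts H.pair_no_loops H.pair_sym_arcs
    by (force simp: symmetric_def dest: symD)+
  have fin: "finite (pverts (G \<odot> H))"
    by (simp add: corona_def G.pair_finite_verts H.pair_finite_verts)
  have sub: "parcs (G \<odot> H) \<subseteq> pverts (G \<odot> H) \<times> pverts (G \<odot> H)"
    by (auto simp: corona_def G1 H1)
  have sym: "sym (parcs (G \<odot> H))"
    by (auto simp: corona_def sym_def G1 H1)
  show ?thesis
  proof
    show "finite (parcs (G \<odot> H))"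
      using fin sub by (meson finite_SigmaI finite_subset)
  next
    fix e assume "e \<in> parcs (G \<odot> H)"
    then show "fst e \<noteq> snd e" by (auto simp: corona_def dest: G1 H1)
  qed (use fin sub sym in \<open>auto simp: symmetric_def\<close>)
qed

end

theory Submission
  imports Defs
begin

text \<open>
  A set of vertices dominates the corona iff, for every vertex \<open>v\<close> of \<open>G\<close>, it contains \<open>v\<close> or
  dominates the copy of \<open>H\<close> at \<open>v\<close>; so the game splits into \<open>n(G)\<close> independent boards. For the
  upper bounds Dominator answers a move on a vertex of \<open>G\<close> by taking another vertex of \<open>G\<close>, answers
  a move in a copy of \<open>H\<close> by taking its vertex of \<open>G\<close> if this is still free, and follows an optimal
  S-game strategy in the copies whose vertex of \<open>G\<close> belongs to Staller. For the lower bounds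
  Staller also answers a vertex of \<open>G\<close> by a vertex of \<open>G\<close>, and answers a move in a copy of \<open>H\<close> by an
  optimal reply of the D-game in the same copy. Both strategies are analysed by a potential: the sum
  of the values of the boards not yet decided by their vertex of \<open>G\<close>, minus what Dominator can still
  save on the \<open>m\<close> boards whose vertex of \<open>G\<close> is free.
\<close>

section \<open>Positional Maker-Breaker games\<close>

text \<open>
  \<open>D_wins W V k A B\<close>: Dominator, who is to move, owns \<open>A\<close>, and Staller owns \<open>B\<close>; he can reach a set
  satisfying \<open>W\<close> with at most \<open>k\<close> further moves. \<open>S_wins\<close> is the same with Staller to move.
\<close>

primrec D_wins :: "('a set \<Rightarrow> bool) \<Rightarrow> 'a set \<Rightarrow> nat \<Rightarrow> 'a set \<Rightarrow> 'a set \<Rightarrow> bool" where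
  "D_wins W V 0 A B \<longleftrightarrow> W A"
| "D_wins W V (Suc k) A B \<longleftrightarrow> W A \<or> (\<exists>x\<in>V - (A \<union> B). W (insert x A) \<or>
     V - (insert x A \<union> B) \<noteq> {} \<and>
     (\<forall>y\<in>V - (insert x A \<union> B). D_wins W V k (insert x A) (insert y B)))"

definition S_wins :: "('a set \<Rightarrow> bool) \<Rightarrow> 'a set \<Rightarrow> nat \<Rightarrow> 'a set \<Rightarrow> 'a set \<Rightarrow> bool" where
  "S_wins W V k A B \<longleftrightarrow> W A \<or>
     V - (A \<union> B) \<noteq> {} \<and> (\<forall>y\<in>V - (A \<union> B). D_wins W V k A (insert y B))"

text \<open>\<open>S_wins\<close> is defined from \<open>D_wins\<close>, so the recursion has it
  unfolded; folding it back gives the usual alternation of turns, the form used from here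
  on.\<close>

lemma D_wins_Suc:
  "D_wins W V (Suc k) A B \<longleftrightarrow> W A \<or> (\<exists>x\<in>V - (A \<union> B). S_wins W V k (insert x A) B)"
  by (simp add: S_wins_def)

declare D_wins.simps(2) [simp del]

lemma D_wins_if_goal: "W A \<Longrightarrow> D_wins W V k A B"
  by (cases k) (simp_all add: D_wins_Suc)

text \<open>This rests on the clause \<open>V - (A \<union> B) \<noteq> {}\<close>: without it the
  quantifier over Staller's replies would make every full board a vacuous win.\<close>

lemma S_wins_0: "S_wins W V 0 A B \<longleftrightarrow> W A"
  by (auto simp: S_wins_def)

lemma S_wins_D_wins: "S_wins W V k A B \<Longrightarrow> y \<in> V - (A \<union> B) \<Longrightarrow> D_wins W V k A (insert y B)"
  by (auto simp: S_wins_def intro: D_wins_if_goal)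

lemma D_wins_full: "D_wins W V k A B \<Longrightarrow> V - (A \<union> B) = {} \<Longrightarrow> W A"
  by (cases k) (auto simp: D_wins_Suc)

text \<open>Dominator makes the same moves against the smaller set; fewer Staller vertices cannot
  hurt him.\<close>

lemma D_wins_antimono: "D_wins W V k A B \<Longrightarrow> B' \<subseteq> B \<Longrightarrow> D_wins W V k A B'"
proof (induction k arbitrary: A B B')
  case 0
  then show ?case by simp
next
  case (Suc k)
  show ?case
  proof (cases "W A")
    case False
    then obtain x where x: "x \<in> V - (A \<union> B)" and S: "S_wins W V k (insert x A) B"
      using Suc.prems by (auto simp: D_wins_Suc)
    have "S_wins W V k (insert x A) B'"
    proof (cases "W (insert x A)")
      case nW: False
      then obtain y0 where y0: "y0 \<in> V - (insert x A \<union> B)"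
        using S by (auto simp: S_wins_def)
      have "D_wins W V k (insert x A) (insert y B')" if y: "y \<in> V - (insert x A \<union> B')" for y
      proof (cases "y \<in> B")
        case True
        \<comment> \<open>In the larger position \<open>y\<close> is already Staller's, so there she
          plays the arbitrary free vertex \<open>y0\<close> instead.\<close>
        then have "insert y B' \<subseteq> insert y0 B" using Suc.prems by auto
        then show ?thesis using Suc.IH S_wins_D_wins[OF S y0] by blast
      next
        case False
        then have "y \<in> V - (insert x A \<union> B)" using y by auto
        then show ?thesis using Suc.IH S_wins_D_wins[OF S] Suc.prems(2) by blast
      qed
      then show ?thesis using y0 Suc.prems(2) by (auto simp: S_wins_def)
    qed (simp add: S_wins_def)
    then show ?thesis using x Suc.prems(2) by (auto simp: D_wins_Suc)
  qed (simp add: D_wins_if_goal)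
qed

lemma S_wins_imp_D_wins: "S_wins W V k A B \<Longrightarrow> D_wins W V k A B"
  by (auto simp: S_wins_def intro: D_wins_if_goal D_wins_antimono)

section \<open>Strategies and positions\<close>

definition has_dominating_subset :: "'a pair_pre_digraph \<Rightarrow> 'a set \<Rightarrow> bool" where
  "has_dominating_subset G A \<longleftrightarrow> (\<exists>A'\<subseteq>A. dominating_set G A')"

lemma has_dominating_subset_mono: "has_dominating_subset G A \<Longrightarrow> A \<subseteq> B \<Longrightarrow> has_dominating_subset G B"
  by (auto simp: has_dominating_subset_def)

lemma not_has_dominating_subset_empty: "pverts G \<noteq> {} \<Longrightarrow> \<not> has_dominating_subset G {}"
  by (auto simp: has_dominating_subset_def dominating_set_def)

text \<open>\<open>t\<close> says whether Dominator is to move, so that one invariant covers both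
  turns of both games.\<close>

definition position_wins :: "'a pair_pre_digraph \<Rightarrow> bool \<Rightarrow> nat \<Rightarrow> 'a set \<Rightarrow> 'a set \<Rightarrow> bool" where
  "position_wins G t = (if t then D_wins else S_wins) (has_dominating_subset G) (pverts G)"

lemma position_wins_if_dominated: "has_dominating_subset G A \<Longrightarrow> position_wins G t k A B"
  by (simp add: position_wins_def S_wins_def D_wins_if_goal)

lemma dominator_turn_Suc: "dominator_turn g (Suc i) \<longleftrightarrow> \<not> dominator_turn g i"
  by (cases g) auto

lemma dominator_moves_snoc:
  "dominator_moves g (p @ [x]) = dominator_moves g p @ (if dominator_turn g (length p) then [x] else [])"
  by (simp add: dominator_moves_def nths_append)

lemma dominator_moves_Nil: "dominator_moves g [] = []"
  by (simp add: dominator_moves_def)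

lemma set_dominator_moves: "set (dominator_moves g p) \<subseteq> set p"
  by (simp add: dominator_moves_def set_nths_subset)

lemma consistent_snoc:
  "consistent g \<sigma> (p @ [x]) \<longleftrightarrow> consistent g \<sigma> p \<and> (dominator_turn g (length p) \<longrightarrow> x = \<sigma> p)"
  by (auto simp: consistent_def nth_append less_Suc_eq)

lemma play_snoc: "play G (p @ [x]) \<longleftrightarrow> play G p \<and> x \<in> pverts G - set p"
  by (auto simp: play_def)

text \<open>Backward induction on the number of free vertices, along consistent plays. Plays run on
  after a win, hence the case split: once Dominator has made \<open>k\<close> moves, his first
  \<open>k\<close> moves are fixed and must already dominate.\<close>

lemma position_of_strategy:
  assumes fin: "finite (pverts G)" and win: "wins_within g G \<sigma> k"
    and "play G p" and "consistent g \<sigma> p"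
  defines "dm \<equiv> dominator_moves g"
  shows "if k \<le> length (dm p) then has_dominating_subset G (set (take k (dm p)))
    else position_wins G (dominator_turn g (length p)) (k - length (dm p))
      (set (dm p)) (set p - set (dm p))"
  using assms(3,4)
proof (induction "card (pverts G - set p)" arbitrary: p rule: less_induct)
  case less
  have sub: "set (dm p) \<subseteq> set p" by (simp add: dm_def set_dominator_moves)
  then have un: "set (dm p) \<union> (set p - set (dm p)) = set p" by auto
  have next_: "if k \<le> length (dm (p @ [x])) then has_dominating_subset G (set (take k (dm (p @ [x]))))
    else position_wins G (dominator_turn g (length (p @ [x]))) (k - length (dm (p @ [x])))
      (set (dm (p @ [x]))) (set (p @ [x]) - set (dm (p @ [x])))"
    if "x \<in> pverts G - set p" "dominator_turn g (length p) \<longrightarrow> x = \<sigma> p" for x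
  proof (rule less.hyps)
    show "card (pverts G - set (p @ [x])) < card (pverts G - set p)"
      by (rule psubset_card_mono) (use fin that in auto)
  qed (use less.prems that in \<open>auto simp: play_snoc consistent_snoc\<close>)
  show ?case
  proof (cases "set p = pverts G")
    case True
    then have "complete_play G p" using less.prems by (simp add: complete_play_def play_def)
    then have "has_dominating_subset G (set (take k (dm p)))"
      using win less.prems by (auto simp: wins_within_def has_dominating_subset_def dm_def)
    then show ?thesis by (auto intro: position_wins_if_dominated)
  next
    case ne: False
    show ?thesis
    proof (cases "dominator_turn g (length p)")
      case True
      have x: "\<sigma> p \<in> pverts G - set p"
        using win less.prems True ne unfolding wins_within_def dominator_strategy_def by blast
      have "dm (p @ [\<sigma> p]) = dm p @ [\<sigma> p]" using True by (simp add: dm_def dominator_moves_snoc)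
      moreover have "set (p @ [\<sigma> p]) - set (dm p @ [\<sigma> p]) = set p - set (dm p)" using x by auto
      ultimately have n: "if k \<le> Suc (length (dm p)) then has_dominating_subset G (set (take k (dm p @ [\<sigma> p])))
        else position_wins G False (k - Suc (length (dm p)))
          (insert (\<sigma> p) (set (dm p))) (set p - set (dm p))"
        using next_[OF x] True by (simp add: dominator_turn_Suc cong: if_cong)
      show ?thesis
      proof (cases "k \<le> length (dm p)")
        case True
        then show ?thesis using n by simp
      next
        case False
        then obtain j where j: "k - length (dm p) = Suc j" "k - Suc (length (dm p)) = j"
          by (metis Suc_diff_Suc not_le)
        have "position_wins G False j (insert (\<sigma> p) (set (dm p))) (set p - set (dm p))"
          using n False j by (auto split: if_splits intro: position_wins_if_dominated)
        then show ?thesis using False True x un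
          by (auto simp: position_wins_def j D_wins_Suc)
      qed
    next
      case False
      obtain x0 where x0: "x0 \<in> pverts G - set p" using ne less.prems by (auto simp: play_def)
      have *: "dm (p @ [x]) = dm p" for x using False by (simp add: dm_def dominator_moves_snoc)
      have "insert x (set p) - set (dm p) = insert x (set p - set (dm p))"
        if "x \<in> pverts G - set p" for x using that sub by auto
      then show ?thesis using next_ False x0 un
        by (auto simp: * position_wins_def S_wins_def dominator_turn_Suc)
    qed
  qed
qed

text \<open>The choice keeps a won position whenever some move does, and is still a free vertex
  otherwise, because \<open>dominator_strategy\<close> asks for legal moves also after the
  win.\<close>

definition greedy_strategy :: "game \<Rightarrow> 'a pair_pre_digraph \<Rightarrow> nat \<Rightarrow> 'a list \<Rightarrow> 'a" where
  "greedy_strategy g G k p = (SOME x. x \<in> pverts G - set p \<and>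
     ((\<exists>x'\<in>pverts G - set p. position_wins G False (k - Suc (length (dominator_moves g p)))
         (insert x' (set (dominator_moves g p))) (set p - set (dominator_moves g p))) \<longrightarrow>
       position_wins G False (k - Suc (length (dominator_moves g p)))
         (insert x (set (dominator_moves g p))) (set p - set (dominator_moves g p))))"

lemma greedy_strategy:
  assumes "pverts G - set p \<noteq> {}"
  shows "greedy_strategy g G k p \<in> pverts G - set p"
    and "\<exists>x'\<in>pverts G - set p. position_wins G False (k - Suc (length (dominator_moves g p)))
         (insert x' (set (dominator_moves g p))) (set p - set (dominator_moves g p)) \<Longrightarrow>
       position_wins G False (k - Suc (length (dominator_moves g p)))
         (insert (greedy_strategy g G k p) (set (dominator_moves g p)))
         (set p - set (dominator_moves g p))"
proof -
  let ?P = "\<lambda>x. position_wins G False (k - Suc (length (dominator_moves g p)))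
         (insert x (set (dominator_moves g p))) (set p - set (dominator_moves g p))"
  have "\<exists>x. x \<in> pverts G - set p \<and> ((\<exists>x'\<in>pverts G - set p. ?P x') \<longrightarrow> ?P x)"
    using assms by blast
  from someI_ex[OF this, folded greedy_strategy_def]
  show "greedy_strategy g G k p \<in> pverts G - set p"
    and "\<exists>x'\<in>pverts G - set p. ?P x' \<Longrightarrow> ?P (greedy_strategy g G k p)"
    by blast+
qed

lemma greedy_strategy_invariant:
  assumes "position_wins G (dominator_turn g 0) k {} {}"
    and "play G p" and "consistent g (greedy_strategy g G k) p"
  defines "dm \<equiv> dominator_moves g"
  shows "has_dominating_subset G (set (take k (dm p))) \<or> length (dm p) \<le> k \<and>
    position_wins G (dominator_turn g (length p)) (k - length (dm p))
      (set (dm p)) (set p - set (dm p))"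
  using assms(2,3)
proof (induction p rule: rev_induct)
  case Nil
  then show ?case using assms(1) by (simp add: dm_def dominator_moves_Nil)
next
  case (snoc x p)
  have sub: "set (dm p) \<subseteq> set p" by (simp add: dm_def set_dominator_moves)
  then have un: "set (dm p) \<union> (set p - set (dm p)) = set p" by auto
  have x: "x \<in> pverts G - set p" using snoc.prems by (simp add: play_snoc)
  have dm: "dm (p @ [x]) = dm p @ (if dominator_turn g (length p) then [x] else [])"
    by (simp add: dm_def dominator_moves_snoc)
  consider (dom) "has_dominating_subset G (set (take k (dm p)))"
    | (pos) "length (dm p) \<le> k" "\<not> has_dominating_subset G (set (dm p))"
        "position_wins G (dominator_turn g (length p)) (k - length (dm p))
          (set (dm p)) (set p - set (dm p))"
    using snoc by (fastforce simp: play_snoc consistent_snoc)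
  then show ?case
  proof cases
    case dom
    then have "has_dominating_subset G (set (take k (dm (p @ [x]))))"
      by (rule has_dominating_subset_mono) (simp add: dm)
    then show ?thesis ..
  next
    case pos
    show ?thesis
    proof (cases "dominator_turn g (length p)")
      case True
      then have D: "D_wins (has_dominating_subset G) (pverts G) (k - length (dm p))
          (set (dm p)) (set p - set (dm p))" using pos by (simp add: position_wins_def)
      \<comment> \<open>With no moves left, \<open>D_wins\<close> would mean that the goal is
        reached, which this case excludes.\<close>
      then obtain j where j: "k - length (dm p) = Suc j" "k - Suc (length (dm p)) = j"
        using pos by (cases "k - length (dm p)") auto
      have ex: "\<exists>x'\<in>pverts G - set p. position_wins G False j
          (insert x' (set (dm p))) (set p - set (dm p))"
        using D pos un by (auto simp: j D_wins_Suc position_wins_def)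
      have "x = greedy_strategy g G k p" using True snoc.prems by (simp add: consistent_snoc)
      then have "position_wins G False j (insert x (set (dm p))) (set p - set (dm p))"
        using greedy_strategy(2)[of G p k g] ex x j unfolding dm_def by auto
      moreover have "insert x (set p) - insert x (set (dm p)) = set p - set (dm p)"
        using x by auto
      moreover have "Suc (length (dm p)) \<le> k" using j by linarith
      ultimately show ?thesis using True j by (simp add: dm dominator_turn_Suc)
    next
      case False
      have "insert x (set p) - set (dm p) = insert x (set p - set (dm p))"
        using x sub by auto
      then show ?thesis using False pos x un
        by (auto simp: dm dominator_turn_Suc position_wins_def S_wins_def)
    qed
  qed
qed

lemma wins_within_iff_position_wins:
  assumes "finite (pverts G)"
  shows "(\<exists>\<sigma>. wins_within g G \<sigma> k) \<longleftrightarrow> position_wins G (dominator_turn g 0) k {} {}"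
proof
  assume "\<exists>\<sigma>. wins_within g G \<sigma> k"
  then obtain \<sigma> where "wins_within g G \<sigma> k" ..
  from position_of_strategy[OF assms this, of "[]"]
  show "position_wins G (dominator_turn g 0) k {} {}"
    by (auto simp: play_def consistent_def dominator_moves_Nil split: if_splits
        intro: position_wins_if_dominated)
next
  assume *: "position_wins G (dominator_turn g 0) k {} {}"
  have "wins_within g G (greedy_strategy g G k) k"
    unfolding wins_within_def
  proof (intro conjI allI impI)
    show "dominator_strategy g G (greedy_strategy g G k)"
      unfolding dominator_strategy_def
    proof (intro allI impI)
      fix p assume "play G p \<and> consistent g (greedy_strategy g G k) p \<and>
        dominator_turn g (length p) \<and> set p \<noteq> pverts G"
      then show "greedy_strategy g G k p \<in> pverts G - set p"
        by (intro greedy_strategy(1)) (auto simp: play_def)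
    qed
  next
    fix p assume p: "complete_play G p \<and> consistent g (greedy_strategy g G k) p"
    let ?dm = "dominator_moves g p"
    have "has_dominating_subset G (set (take k ?dm)) \<or> length ?dm \<le> k \<and>
      position_wins G (dominator_turn g (length p)) (k - length ?dm) (set ?dm) (set p - set ?dm)"
      using p by (intro greedy_strategy_invariant *) (auto simp: complete_play_def play_def)
    moreover have "has_dominating_subset G (set ?dm)"
      if "position_wins G (dominator_turn g (length p)) (k - length ?dm) (set ?dm) (set p - set ?dm)"
    proof -
      have "pverts G - (set ?dm \<union> (set p - set ?dm)) = {}"
        using p by (auto simp: complete_play_def)
      then show ?thesis using that
        by (auto simp: position_wins_def S_wins_def dest: D_wins_full split: if_splits)
    qed
    ultimately have "has_dominating_subset G (set (take k ?dm))" by auto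
    then show "\<exists>A\<subseteq>set (take k ?dm). dominating_set G A" by (simp add: has_dominating_subset_def)
  qed
  then show "\<exists>\<sigma>. wins_within g G \<sigma> k" by blast
qed

section \<open>The game number as the least winning number of moves\<close>

lemma mb_number_eq:
  assumes "finite (pverts G)"
  shows "mb_number g G = Inf {enat k | k. position_wins G (dominator_turn g 0) k {} {}}"
  by (simp add: mb_number_def wins_within_iff_position_wins[OF assms])

lemma mb_number_le:
  assumes "finite (pverts G)" and "position_wins G (dominator_turn g 0) k {} {}"
  shows "mb_number g G \<le> enat k"
  using assms by (auto simp: mb_number_eq intro: Inf_lower)

lemma mb_number_attained:
  assumes "finite (pverts G)" and "mb_number g G = enat k"
  shows "position_wins G (dominator_turn g 0) k {} {}"
proof -
  let ?S = "{enat k | k. position_wins G (dominator_turn g 0) k {} {}}"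
  have Inf: "Inf ?S = enat k" using assms by (simp add: mb_number_eq)
  \<comment> \<open>The infimum is finite, whereas that of the empty set is \<infinity>; a nonempty
    set in \<open>enat\<close> attains its infimum.\<close>
  then have "?S \<noteq> {}" by (metis Inf_enat_def enat.distinct(1))
  then have "Inf ?S \<in> ?S"
    unfolding Inf_enat_def by (metis (lifting) LeastI_ex all_not_in_conv)
  then show ?thesis unfolding Inf by simp
qed

lemma le_mb_number:
  assumes "finite (pverts G)"
    and "\<And>k. position_wins G (dominator_turn g 0) k {} {} \<Longrightarrow> x \<le> enat k"
  shows "x \<le> mb_number g G"
  using assms by (auto simp: mb_number_eq intro: Inf_greatest)

section \<open>The game on disjoint boards with a switch\<close>

definition fiber :: "'a \<Rightarrow> ('a + 'a \<times> 'b) set \<Rightarrow> 'b set" where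
  "fiber v A = {x. Inr (v, x) \<in> A}"

lemma fiber_simps [simp]:
  "fiber v (insert (Inl w) A) = fiber v A"
  "fiber v (insert (Inr (w, x)) A) = (if v = w then insert x (fiber v A) else fiber v A)"
  "fiber v {} = {}"
  by (auto simp: fiber_def)

text \<open>
  The switch of the board \<open>v\<close> is \<open>Inl v\<close>: taking it wins the whole board for Dominator.
\<close>

locale switched_boards =
  fixes I :: "'a set" and X :: "'b set" and W :: "'b set \<Rightarrow> bool"
  assumes finite_boards: "finite I"
begin

definition vertices :: "('a + 'a \<times> 'b) set" where
  "vertices = Inl ` I \<union> Inr ` (I \<times> X)"

definition goal :: "('a + 'a \<times> 'b) set \<Rightarrow> bool" where
  "goal A \<longleftrightarrow> (\<forall>v\<in>I. Inl v \<in> A \<or> W (fiber v A))"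

text \<open>Used for both players: \<open>unswitched A \<inter> unswitched B\<close> are the boards
  with a free switch, \<open>unswitched A - unswitched B\<close> the undecided ones whose switch is
  Staller's.\<close>

definition unswitched :: "('a + 'a \<times> 'b) set \<Rightarrow> 'a set" where
  "unswitched A = {v \<in> I. Inl v \<notin> A}"

lemma vertices_iff [simp]:
  "Inl v \<in> vertices \<longleftrightarrow> v \<in> I"
  "Inr (v, x) \<in> vertices \<longleftrightarrow> v \<in> I \<and> x \<in> X"
  by (auto simp: vertices_def)

lemma finite_unswitched [simp]: "finite (unswitched A)"
  by (simp add: unswitched_def finite_boards)

lemma unswitched_insert [simp]:
  "unswitched (insert (Inl w) A) = unswitched A - {w}"
  "unswitched (insert (Inr z) A) = unswitched A"
  by (auto simp: unswitched_def)

lemma in_unswitched: "v \<in> unswitched A \<longleftrightarrow> v \<in> I \<and> Inl v \<notin> A"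
  by (auto simp: unswitched_def)

lemma not_goalE:
  assumes "\<not> goal A"
  obtains v where "v \<in> unswitched A" "\<not> W (fiber v A)"
  using assms by (auto simp: goal_def in_unswitched)

subsection \<open>Dominator's strategy\<close>

text \<open>
  \<open>r v\<close> bounds Dominator's moves on the copy at \<open>v\<close>. He will own half of the free \<open>Inl v\<close>, and pays
  \<open>1\<close> instead of \<open>r v \<ge> h\<close> on each of these boards.
\<close>

definition upper_invariant where
  "upper_invariant h r K A B \<longleftrightarrow>
     (\<forall>v\<in>unswitched A. S_wins W X (r v) (fiber v A) (fiber v B) \<and>
       (v \<in> unswitched B \<longrightarrow> h \<le> r v)) \<and>
     (\<Sum>v\<in>unswitched A. r v) \<le> K + card (unswitched A \<inter> unswitched B) div 2 * (h - 1)"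

text \<open>With \<open>m\<close> free switches, the invariant gives
  \<open>m * h \<le> m div 2 * (h - 1)\<close>, which forces \<open>m = 0\<close>. Then all
  \<open>r v\<close> vanish, so every undecided copy is already dominated.\<close>

lemma upper_invariant_0:
  assumes inv: "upper_invariant h r 0 A B" and h: "h \<ge> 1"
  shows "goal A"
proof -
  let ?U = "unswitched A \<inter> unswitched B"
  have "card ?U * h \<le> (\<Sum>v\<in>?U. r v)"
    using inv sum_bounded_below[of ?U h r] by (simp add: upper_invariant_def)
  also have "\<dots> \<le> (\<Sum>v\<in>unswitched A. r v)" by (rule sum_mono2) auto
  also have "\<dots> \<le> card ?U div 2 * (h - 1)" using inv by (simp add: upper_invariant_def)
  finally have *: "card ?U * h \<le> card ?U div 2 * (h - 1)" .
  also have "\<dots> \<le> card ?U div 2 * h" by simp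
  finally have "card ?U \<le> card ?U div 2" using h unfolding mult_le_cancel2 by linarith
  then have "card ?U = 0" by linarith
  then have "(\<Sum>v\<in>unswitched A. r v) = 0" using inv by (simp add: upper_invariant_def)
  then have "\<forall>v\<in>unswitched A. W (fiber v A)"
    using inv by (auto simp: upper_invariant_def S_wins_0)
  then show ?thesis using not_goalE by blast
qed

text \<open>The sum loses \<open>r w \<ge> h\<close>. The right side loses \<open>1\<close> for the
  move and at most \<open>h - 1\<close> of the saving, since at most two free switches
  disappear.\<close>

lemma upper_invariant_take_switch:
  assumes inv: "upper_invariant h r (Suc K) A B" and h: "h \<ge> 1"
    and w: "w \<in> unswitched A" "w \<in> unswitched B"
    and B': "\<And>v. v \<noteq> w \<Longrightarrow> fiber v B' = fiber v B" "unswitched B' \<subseteq> unswitched B"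
    and card: "card (unswitched A \<inter> unswitched B) \<le>
      card (unswitched (insert (Inl w) A) \<inter> unswitched B') + 2"
  shows "upper_invariant h r K (insert (Inl w) A) B'"
proof -
  let ?m = "card (unswitched A \<inter> unswitched B)"
  let ?m' = "card (unswitched (insert (Inl w) A) \<inter> unswitched B')"
  have "?m div 2 \<le> ?m' div 2 + 1" using card by linarith
  then have "?m div 2 * (h - 1) \<le> ?m' div 2 * (h - 1) + (h - 1)"
    by (metis add_mult_distrib mult_le_mono1 mult_1)
  moreover have "(\<Sum>v\<in>unswitched A. r v) = r w + (\<Sum>v\<in>unswitched A - {w}. r v)"
    using w by (simp add: sum.remove)
  moreover have "h \<le> r w" using inv w by (auto simp: upper_invariant_def)
  ultimately have "(\<Sum>v\<in>unswitched A - {w}. r v) \<le> K + ?m' div 2 * (h - 1)"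
    using inv h unfolding upper_invariant_def by linarith
  then show ?thesis using inv B' by (auto simp: upper_invariant_def)
qed

lemma upper_invariant_play_copy:
  assumes inv: "upper_invariant h r (Suc K) A B"
    and v: "v \<in> unswitched A" "v \<notin> unswitched B" "r v = Suc j"
    and S: "S_wins W X j (insert x (fiber v A)) (fiber v B')"
    and B': "\<And>u. u \<noteq> v \<Longrightarrow> fiber u B' = fiber u B" "unswitched B' = unswitched B"
  shows "upper_invariant h (r(v := j)) K (insert (Inr (v, x)) A) B'"
proof -
  have "(\<Sum>u\<in>unswitched A. r u) = Suc (\<Sum>u\<in>unswitched A. (r(v := j)) u)"
    using v by (simp add: sum.remove[of _ v])
  then show ?thesis using inv v S B' by (auto simp: upper_invariant_def)
qed

text \<open>Moving first on a copy is no worse than moving second, so the bounds \<open>r v\<close> still apply.\<close>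

lemma upper_invariant_free_move:
  assumes inv: "upper_invariant h r (Suc K) A B" and h: "h \<ge> 1" and ng: "\<not> goal A"
  shows "\<exists>x\<in>vertices - (A \<union> B). \<exists>r'. upper_invariant h r' K (insert x A) B"
proof (cases "unswitched A \<inter> unswitched B = {}")
  case False
  then obtain w where w: "w \<in> unswitched A" "w \<in> unswitched B" by auto
  have "(unswitched A - {w}) \<inter> unswitched B = (unswitched A \<inter> unswitched B) - {w}" by auto
  then have "card (unswitched A \<inter> unswitched B) \<le> card ((unswitched A - {w}) \<inter> unswitched B) + 2"
    using w by (simp add: card_Diff_singleton)
  then have "upper_invariant h r K (insert (Inl w) A) B"
    by (intro upper_invariant_take_switch[OF inv h w]) auto
  then show ?thesis using w by (intro bexI[of _ "Inl w"]) (auto simp: in_unswitched)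
next
  case True
  obtain v where v: "v \<in> unswitched A" "\<not> W (fiber v A)" using ng by (rule not_goalE)
  then have "D_wins W X (r v) (fiber v A) (fiber v B)"
    using inv by (auto simp: upper_invariant_def intro: S_wins_imp_D_wins)
  then obtain j x where j: "r v = Suc j" "x \<in> X - (fiber v A \<union> fiber v B)"
      "S_wins W X j (insert x (fiber v A)) (fiber v B)"
    using v by (cases "r v") (auto simp: D_wins_Suc)
  then have "upper_invariant h (r(v := j)) K (insert (Inr (v, x)) A) B"
    using True v by (intro upper_invariant_play_copy[OF inv]) auto
  then show ?thesis using j v
    by (intro bexI[of _ "Inr (v, x)"]) (auto simp: in_unswitched fiber_def)
qed

lemma upper_invariant_reply:
  assumes inv: "upper_invariant h r (Suc K) A B" and h: "h \<ge> 1" and ng: "\<not> goal A"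
    and y: "y \<in> vertices - (A \<union> B)"
  shows "\<exists>x\<in>vertices - (A \<union> insert y B). \<exists>r'. upper_invariant h r' K (insert x A) (insert y B)"
proof (cases y)
  case (Inl v)
  then have v: "v \<in> unswitched A" "v \<in> unswitched B" using y by (auto simp: in_unswitched)
  let ?U = "unswitched A \<inter> unswitched B"
  show ?thesis
  proof (cases "?U = {v}")
    \<comment> \<open>Staller took the last free switch: \<open>1 div 2 = 0 div 2\<close>, so no
      saving is lost and Dominator has a free move.\<close>
    case True
    then have "unswitched A \<inter> (unswitched B - {v}) = {}" by auto
    then have "upper_invariant h r (Suc K) A (insert y B)"
      using inv True by (simp add: upper_invariant_def Inl)
    from upper_invariant_free_move[OF this h ng] show ?thesis .
  next
    case False
    then obtain w where w: "w \<in> unswitched A" "w \<in> unswitched B" "w \<noteq> v" using v by auto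
    let ?U' = "unswitched (insert (Inl w) A) \<inter> unswitched (insert y B)"
    have "?U = insert v (insert w ?U')" using v w by (auto simp: Inl)
    moreover have "card (insert v (insert w ?U')) \<le> card ?U' + 2" by (simp add: card_insert_if)
    ultimately have "card ?U \<le> card ?U' + 2" by simp
    then have "upper_invariant h r K (insert (Inl w) A) (insert y B)"
      by (intro upper_invariant_take_switch[OF inv h w(1,2)]) (auto simp: Inl)
    then show ?thesis using w Inl
      by (intro bexI[of _ "Inl w"]) (auto simp: in_unswitched)
  qed
next
  case (Inr vz)
  then obtain v z where yv: "y = Inr (v, z)" by (cases vz) auto
  then have v: "v \<in> I" and z: "z \<in> X - (fiber v A \<union> fiber v B)" using y by (auto simp: fiber_def)
  show ?thesis
  proof (cases "v \<in> unswitched A")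
    case False
    then have "upper_invariant h r (Suc K) A (insert y B)"
      using inv by (auto simp: upper_invariant_def yv)
    from upper_invariant_free_move[OF this h ng] show ?thesis .
  next
    case vA: True
    show ?thesis
    proof (cases "v \<in> unswitched B")
      case True
      have "(unswitched A - {v}) \<inter> unswitched B = (unswitched A \<inter> unswitched B) - {v}" by auto
      then have "card (unswitched A \<inter> unswitched B) \<le>
          card ((unswitched A - {v}) \<inter> unswitched B) + 2"
        using vA True by (simp add: card_Diff_singleton)
      \<comment> \<open>Taking the switch removes \<open>v\<close> from the invariant, so the copy
        disturbed by \<open>z\<close> needs no further analysis.\<close>
      then have "upper_invariant h r K (insert (Inl v) A) (insert y B)"
        by (intro upper_invariant_take_switch[OF inv h vA True]) (auto simp: yv)
      then show ?thesis using vA True yv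
        by (intro bexI[of _ "Inl v"]) (auto simp: in_unswitched)
    next
      case vB: False
      have S: "S_wins W X (r v) (fiber v A) (fiber v B)"
        using inv vA by (auto simp: upper_invariant_def)
      show ?thesis
      proof (cases "W (fiber v A)")
        case True
        then have "upper_invariant h r (Suc K) A (insert y B)"
          using inv by (auto simp: upper_invariant_def yv S_wins_def)
        from upper_invariant_free_move[OF this h ng] show ?thesis .
      next
        case False
        obtain j x where j: "r v = Suc j" "x \<in> X - (fiber v A \<union> insert z (fiber v B))"
            "S_wins W X j (insert x (fiber v A)) (insert z (fiber v B))"
          using S_wins_D_wins[OF S z] False by (cases "r v") (auto simp: D_wins_Suc)
        then have "upper_invariant h (r(v := j)) K (insert (Inr (v, x)) A) (insert y B)"
          using vA vB by (intro upper_invariant_play_copy[OF inv]) (auto simp: yv)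
        then show ?thesis using j v yv
          by (intro bexI[of _ "Inr (v, x)"]) (auto simp: fiber_def)
      qed
    qed
  qed
qed

lemma upper_invariant_S_wins:
  assumes "upper_invariant h r K A B" and h: "h \<ge> 1"
  shows "S_wins goal vertices K A B"
  using assms(1)
proof (induction K arbitrary: r A B)
  case 0
  then show ?case using upper_invariant_0 h by (auto simp: S_wins_def)
next
  case (Suc K)
  show ?case
  proof (cases "goal A")
    case False
    have "D_wins goal vertices (Suc K) A (insert y B)" if "y \<in> vertices - (A \<union> B)" for y
      using upper_invariant_reply[OF Suc.prems h False that] Suc.IH by (auto simp: D_wins_Suc)
    \<comment> \<open>The free move only serves to show that some vertex is free, as
      \<open>S_wins\<close> demands.\<close>
    then show ?thesis
      using upper_invariant_free_move[OF Suc.prems h False] by (auto simp: S_wins_def)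
  qed (simp add: S_wins_def)
qed

text \<open>At the start each of the \<open>n\<close> boards costs \<open>h\<close> and all switches
  are free; the budget is \<open>n * h - n div 2 * (h - 1)\<close>.\<close>

lemma S_wins_upper:
  assumes S: "S_wins W X h {} {}" and h: "h \<ge> 1"
  shows "S_wins goal vertices (card I div 2 + (card I + 1) div 2 * h) {} {}"
proof -
  have "card I = card I div 2 + (card I + 1) div 2" by linarith
  then have "card I * h = card I div 2 * h + (card I + 1) div 2 * h" by (metis add_mult_distrib)
  then have "card I * h \<le> card I div 2 + (card I + 1) div 2 * h + card I div 2 * (h - 1)"
    using h by (simp add: diff_mult_distrib2)
  then have "upper_invariant h (\<lambda>_. h) (card I div 2 + (card I + 1) div 2 * h) {} {}"
    using S by (simp add: upper_invariant_def unswitched_def)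
  then show ?thesis using h by (rule upper_invariant_S_wins)
qed

text \<open>Dominator opens with a switch, which leaves the S-game on \<open>m = n - 1\<close>
  boards; rounding \<open>m\<close> up and down swaps the roles of the two halves of
  \<open>n\<close>.\<close>

lemma D_wins_upper:
  assumes S: "S_wins W X h {} {}" and h: "h \<ge> 1" and I: "I \<noteq> {}"
  shows "D_wins goal vertices ((card I + 1) div 2 + card I div 2 * h) {} {}"
proof -
  obtain w where w: "w \<in> I" using I by auto
  obtain m where card: "card I = Suc m" "card (I - {w}) = m"
    using w finite_boards by (metis card_Suc_Diff1)
  have "m = m div 2 + (m + 1) div 2" by linarith
  then have "m * h = m div 2 * h + (m + 1) div 2 * h" by (metis add_mult_distrib)
  then have "m * h \<le> m div 2 + (m + 1) div 2 * h + m div 2 * (h - 1)"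
    using h by (simp add: diff_mult_distrib2)
  moreover have "unswitched {} = I" "(I - {w}) \<inter> I = I - {w}" by (auto simp: unswitched_def)
  ultimately have "upper_invariant h (\<lambda>_. h) (m div 2 + (m + 1) div 2 * h) {Inl w} {}"
    using S card by (simp add: upper_invariant_def)
  then have "S_wins goal vertices (m div 2 + (m + 1) div 2 * h) {Inl w} {}"
    using h by (rule upper_invariant_S_wins)
  then have "D_wins goal vertices (Suc (m div 2 + (m + 1) div 2 * h)) {} {}"
    using w by (auto simp: D_wins_Suc)
  then show ?thesis by (simp add: card)
qed

subsection \<open>Staller's strategy\<close>

text \<open>
  \<open>q v\<close> bounds Dominator's moves on the copy at \<open>v\<close> from below. Dominator takes at most half,
  rounded up, of the free \<open>Inl v\<close>, and saves at most \<open>q v - 1 \<le> c - 1\<close> by each of them.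
\<close>

definition lower_invariant where
  "lower_invariant c q P A B \<longleftrightarrow>
     (\<forall>v\<in>unswitched A. (\<forall>j. q v = Suc j \<longrightarrow> \<not> D_wins W X j (fiber v A) (fiber v B)) \<and>
       (v \<in> unswitched B \<longrightarrow> q v \<le> c)) \<and>
     P + (card (unswitched A \<inter> unswitched B) + 1) div 2 * (c - 1) \<le> (\<Sum>v\<in>unswitched A. q v)"

lemma lower_invariant_goal:
  assumes "lower_invariant c q P A B" and "goal A"
  shows "P = 0"
proof -
  have "q v = 0" if "v \<in> unswitched A" for v
  proof -
    have "W (fiber v A)" using assms(2) that by (auto simp: goal_def in_unswitched)
    then have "\<nexists>j. q v = Suc j"
      using assms(1) that D_wins_if_goal unfolding lower_invariant_def by blast
    then show ?thesis using not0_implies_Suc by blast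
  qed
  then show ?thesis using assms by (simp add: lower_invariant_def)
qed

lemma lower_invariant_extra_move:
  assumes inv: "lower_invariant c q P A B"
  shows "lower_invariant c q P A (insert y B)"
proof -
  have sub: "unswitched (insert y B) \<subseteq> unswitched B" by (auto simp: unswitched_def)
  then have "card (unswitched A \<inter> unswitched (insert y B)) \<le> card (unswitched A \<inter> unswitched B)"
    by (intro card_mono) auto
  then have "(card (unswitched A \<inter> unswitched (insert y B)) + 1) div 2 * (c - 1) \<le>
      (card (unswitched A \<inter> unswitched B) + 1) div 2 * (c - 1)"
    by (intro mult_le_mono1 div_le_mono) simp
  then have "P + (card (unswitched A \<inter> unswitched (insert y B)) + 1) div 2 * (c - 1) \<le>
      (\<Sum>v\<in>unswitched A. q v)"
    using inv unfolding lower_invariant_def by linarith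
  moreover have "D_wins W X j (fiber v A) (fiber v B)"
    if "D_wins W X j (fiber v A) (fiber v (insert y B))" for j v
    using that by (rule D_wins_antimono) (auto simp: fiber_def)
  ultimately show ?thesis using inv sub unfolding lower_invariant_def by blast
qed

text \<open>The first alternative covers the moves of Dominator that need no answer; the second
  gives the answer on the same kind of vertex, a switch or the same copy.\<close>

lemma lower_invariant_reply:
  assumes inv: "lower_invariant c q (Suc P) A B" and c: "c \<ge> 1"
    and x: "x \<in> vertices - (A \<union> B)"
  shows "(\<exists>q'. lower_invariant c q' P (insert x A) B) \<or>
    (\<exists>y\<in>vertices - (insert x A \<union> B). \<exists>q'. lower_invariant c q' P (insert x A) (insert y B))"
proof (cases x)
  case (Inl v)
  then have v: "v \<in> unswitched A" "v \<in> unswitched B" using x by (auto simp: in_unswitched)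
  let ?U = "unswitched A \<inter> unswitched B"
  have sum: "(\<Sum>u\<in>unswitched A. q u) = q v + (\<Sum>u\<in>unswitched A - {v}. q u)"
    using v by (simp add: sum.remove)
  have qv: "q v \<le> c" using inv v by (auto simp: lower_invariant_def)
  \<comment> \<open>\<open>m'\<close> counts the free switches after the exchange. The rounded-up
    half falls by one when two switches go, and also when the last one goes.\<close>
  have step: "P + (m' + 1) div 2 * (c - 1) \<le> (\<Sum>u\<in>unswitched A - {v}. q u)"
    if "(card ?U + 1) div 2 = Suc ((m' + 1) div 2)" for m'
    using inv sum qv c that unfolding lower_invariant_def by simp
  show ?thesis
  proof (cases "?U = {v}")
    case True
    then have "(unswitched A - {v}) \<inter> unswitched B = {}" by auto
    then have "lower_invariant c q P (insert x A) B"
      using inv step[of 0] True by (auto simp: lower_invariant_def Inl)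
    then show ?thesis by blast
  next
    case False
    then obtain w where w: "w \<in> unswitched A" "w \<in> unswitched B" "w \<noteq> v" using v by auto
    let ?U' = "(unswitched A - {v}) \<inter> (unswitched B - {w})"
    have "?U = insert v (insert w ?U')" "v \<notin> insert w ?U'" "w \<notin> ?U'" using v w by auto
    then have "card ?U = Suc (Suc (card ?U'))" by (metis card_insert_disjoint finite_Int
          finite_Diff finite_insert finite_unswitched)
    then have "lower_invariant c q P (insert x A) (insert (Inl w) B)"
      using inv step[of "card ?U'"] by (auto simp: lower_invariant_def Inl)
    then show ?thesis using w Inl
      by (intro disjI2 bexI[of _ "Inl w"]) (auto simp: in_unswitched)
  qed
next
  case (Inr vz)
  then obtain v z where xv: "x = Inr (v, z)" by (cases vz) auto
  then have v: "v \<in> I" and z: "z \<in> X - (fiber v A \<union> fiber v B)" using x by (auto simp: fiber_def)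
  show ?thesis
  proof (cases "v \<in> unswitched A \<and> q v \<noteq> 0")
    case False
    then have "lower_invariant c q P (insert x A) B"
      using inv by (auto simp: lower_invariant_def xv)
    then show ?thesis by blast
  next
    case True
    then obtain j where vA: "v \<in> unswitched A" and j: "q v = Suc j" by (auto simp: gr0_conv_Suc)
    have "(\<Sum>u\<in>unswitched A. q u) = Suc (\<Sum>u\<in>unswitched A. (q(v := j)) u)"
      using vA j by (simp add: sum.remove[of _ v])
    then have step: "lower_invariant c (q(v := j)) P (insert x A) B'"
      if "\<And>i. j = Suc i \<Longrightarrow> \<not> D_wins W X i (insert z (fiber v A)) (fiber v B')"
        "\<And>u. u \<noteq> v \<Longrightarrow> fiber u B' = fiber u B" "unswitched B' = unswitched B" for B'
      using inv vA j that by (auto simp: lower_invariant_def xv)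
    show ?thesis
    proof (cases "\<exists>i. j = Suc i \<and> D_wins W X i (insert z (fiber v A)) (fiber v B)")
      case False
      then show ?thesis using step[of B] by blast
    next
      case True
      then obtain i where i: "j = Suc i" "D_wins W X i (insert z (fiber v A)) (fiber v B)" by auto
      have "\<not> D_wins W X (Suc i) (fiber v A) (fiber v B)"
        using inv vA j i by (auto simp: lower_invariant_def)
      then have "\<not> S_wins W X i (insert z (fiber v A)) (fiber v B)"
        using z by (auto simp: D_wins_Suc)
      \<comment> \<open>Failure of \<open>S_wins\<close> means a refuting reply or a full copy
        without the goal; \<open>D_wins_full\<close> excludes the latter.\<close>
      then obtain y where y: "y \<in> X - (insert z (fiber v A) \<union> fiber v B)"
          "\<not> D_wins W X i (insert z (fiber v A)) (insert y (fiber v B))"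
        using D_wins_full[OF i(2)] unfolding S_wins_def by blast
      then have "lower_invariant c (q(v := j)) P (insert x A) (insert (Inr (v, y)) B)"
        using i by (intro step) auto
      then show ?thesis using y v xv
        by (intro disjI2 bexI[of _ "Inr (v, y)"]) (auto simp: fiber_def)
    qed
  qed
qed

lemma lower_invariant_D_wins:
  assumes "lower_invariant c q P A B" and "D_wins goal vertices K A B" and c: "c \<ge> 1"
  shows "P \<le> K"
  using assms(1,2)
proof (induction K arbitrary: q P A B)
  case 0
  then show ?case using lower_invariant_goal by auto
next
  case (Suc K)
  show ?case
  proof (cases "P = 0 \<or> goal A")
    case True
    then have "P = 0" using lower_invariant_goal Suc.prems(1) by blast
    then show ?thesis by simp
  next
    case False
    then obtain P' where P: "P = Suc P'" using not0_implies_Suc by auto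
    obtain x where x: "x \<in> vertices - (A \<union> B)" "S_wins goal vertices K (insert x A) B"
      using Suc.prems False by (auto simp: D_wins_Suc)
    have ext: "P' \<le> K" if "lower_invariant c q' P' (insert x A) B" for q'
    proof (cases "goal (insert x A)")
      case True
      then have "P' = 0" using lower_invariant_goal that by blast
      then show ?thesis by simp
    next
      case False
      then obtain y where "y \<in> vertices - (insert x A \<union> B)" using x by (auto simp: S_wins_def)
      then show ?thesis
        using Suc.IH lower_invariant_extra_move[OF that] S_wins_D_wins[OF x(2)] by blast
    qed
    from lower_invariant_reply[OF Suc.prems(1)[unfolded P] c x(1)] have "P' \<le> K"
      using ext Suc.IH S_wins_D_wins[OF x(2)] by blast
    then show ?thesis by (simp add: P)
  qed
qed

text \<open>Price every board at \<open>c\<close>; the bound is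
  \<open>n * c - (n + 1) div 2 * (c - 1)\<close>.\<close>

lemma D_wins_lower:
  assumes nD: "\<not> D_wins W X (c - 1) {} {}" and c: "c \<ge> 1"
    and win: "D_wins goal vertices K {} {}"
  shows "(card I + 1) div 2 + card I div 2 * c \<le> K"
proof -
  have "card I = card I div 2 + (card I + 1) div 2" by linarith
  then have "card I * c = card I div 2 * c + (card I + 1) div 2 * c" by (metis add_mult_distrib)
  then have "(card I + 1) div 2 + card I div 2 * c + (card I + 1) div 2 * (c - 1) \<le> card I * c"
    using c by (simp add: diff_mult_distrib2)
  then have "lower_invariant c (\<lambda>_. c) ((card I + 1) div 2 + card I div 2 * c) {} {}"
    using nD by (auto simp: lower_invariant_def unswitched_def)
  then show ?thesis using win c by (rule lower_invariant_D_wins)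
qed

text \<open>Staller opens with the switch of \<open>w\<close>. That board keeps its price
  \<open>c\<close>, but only \<open>n - 1\<close> switches remain on which Dominator can
  save.\<close>

lemma S_wins_lower:
  assumes nD: "\<not> D_wins W X (c - 1) {} {}" and c: "c \<ge> 1" and I: "I \<noteq> {}"
    and win: "S_wins goal vertices K {} {}"
  shows "card I div 2 + (card I + 1) div 2 * c \<le> K"
proof -
  obtain w where w: "w \<in> I" using I by auto
  obtain m where card: "card I = Suc m" "card (I - {w}) = m"
    using w finite_boards by (metis card_Suc_Diff1)
  have "m = m div 2 + (m + 1) div 2" by linarith
  then have "m * c = m div 2 * c + (m + 1) div 2 * c" by (metis add_mult_distrib)
  then have "(m + 1) div 2 + Suc (m div 2) * c + (m + 1) div 2 * (c - 1) \<le> Suc m * c"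
    using c by (simp add: diff_mult_distrib2)
  moreover have "unswitched {} = I" "I \<inter> (I - {w}) = I - {w}" by (auto simp: unswitched_def)
  ultimately have "lower_invariant c (\<lambda>_. c) ((m + 1) div 2 + Suc (m div 2) * c) {} {Inl w}"
    using nD card by (auto simp: lower_invariant_def)
  moreover have "D_wins goal vertices K {} {Inl w}" using S_wins_D_wins[OF win] w by auto
  ultimately have "(m + 1) div 2 + Suc (m div 2) * c \<le> K"
    using c by (rule lower_invariant_D_wins)
  then show ?thesis by (simp add: card)
qed

end

section \<open>The corona\<close>

text \<open>Outside its own copy, a vertex of the copy at \<open>v\<close> has only the neighbour
  \<open>Inl v\<close>, so without \<open>Inl v\<close> the copy must dominate itself.\<close>

lemma has_dominating_subset_corona:
  assumes ne: "pverts H \<noteq> {}"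
  shows "has_dominating_subset (G \<odot> H) A \<longleftrightarrow>
    (\<forall>v\<in>pverts G. Inl v \<in> A \<or> has_dominating_subset H (fiber v A))"
proof (intro iffI ballI)
  fix v assume dom: "has_dominating_subset (G \<odot> H) A" and v: "v \<in> pverts G"
  then obtain A' where A': "A' \<subseteq> A" "dominating_set (G \<odot> H) A'"
    by (auto simp: has_dominating_subset_def)
  have "dominating_set H (fiber v A')" if "Inl v \<notin> A"
    unfolding dominating_set_def
  proof (intro conjI ballI)
    show "fiber v A' \<subseteq> pverts H"
      using A' by (auto simp: dominating_set_def corona_def fiber_def)
  next
    fix x assume "x \<in> pverts H"
    then have "Inr (v, x) \<in> A' \<or> (\<exists>u\<in>A'. (u, Inr (v, x)) \<in> parcs (G \<odot> H))"
      using A' v by (auto simp: dominating_set_def corona_def)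
    then show "x \<in> fiber v A' \<or> (\<exists>u\<in>fiber v A'. (u, x) \<in> parcs H)"
      using that A' by (auto simp: corona_def fiber_def)
  qed
  moreover have "fiber v A' \<subseteq> fiber v A" using A' by (auto simp: fiber_def)
  ultimately show "Inl v \<in> A \<or> has_dominating_subset H (fiber v A)"
    by (auto simp: has_dominating_subset_def)
next
  assume *: "\<forall>v\<in>pverts G. Inl v \<in> A \<or> has_dominating_subset H (fiber v A)"
  let ?A = "A \<inter> pverts (G \<odot> H)"
  have fib: "\<forall>x\<in>pverts H. Inr (v, x) \<in> ?A \<or> (\<exists>u. Inr (v, u) \<in> ?A \<and> (u, x) \<in> parcs H)"
    if v: "v \<in> pverts G" "Inl v \<notin> A" for v
  proof -
    obtain C where "C \<subseteq> fiber v A" "dominating_set H C"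
      using * v by (auto simp: has_dominating_subset_def)
    then show ?thesis using v unfolding dominating_set_def fiber_def corona_def by fastforce
  qed
  have "z \<in> ?A \<or> (\<exists>u\<in>?A. (u, z) \<in> parcs (G \<odot> H))"
    if z: "z \<in> pverts (G \<odot> H)" for z
  proof -
    consider (1) v where "z = Inl v" "v \<in> pverts G"
      | (2) v x where "z = Inr (v, x)" "v \<in> pverts G" "x \<in> pverts H"
      using z unfolding corona_def by fastforce
    then show ?thesis
    proof cases
      case 1
      \<comment> \<open>A dominating set of the nonempty copy is nonempty, and each of its vertices
        is adjacent to \<open>Inl v\<close>.\<close>
      obtain x where "x \<in> pverts H" using ne by auto
      then have "Inl v \<in> A \<or> (\<exists>u. Inr (v, u) \<in> ?A)" using fib[of v] 1 by blast
      then show ?thesis using 1 by (auto simp: corona_def)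
    next
      case 2
      show ?thesis
      proof (cases "Inl v \<in> A")
        case True
        then show ?thesis using 2 by (auto simp: corona_def)
      next
        case False
        then have "Inr (v, x) \<in> ?A \<or> (\<exists>u. Inr (v, u) \<in> ?A \<and> (u, x) \<in> parcs H)"
          using fib 2 by blast
        then show ?thesis
        proof
          assume "\<exists>u. Inr (v, u) \<in> ?A \<and> (u, x) \<in> parcs H"
          then obtain u where "Inr (v, u) \<in> ?A" "(u, x) \<in> parcs H" by blast
          moreover from this have "(Inr (v, u), z) \<in> parcs (G \<odot> H)"
            using 2 by (auto simp: corona_def)
          ultimately show ?thesis by blast
        qed (use 2 in blast)
      qed
    qed
  qed
  then have "dominating_set (G \<odot> H) ?A" by (auto simp: dominating_set_def)
  then show "has_dominating_subset (G \<odot> H) A"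
    unfolding has_dominating_subset_def by blast
qed

section \<open>Transfer of the bounds to \<open>enat\<close>, and the theorem\<close>

lemma position_wins_empty_pos:
  "pverts G \<noteq> {} \<Longrightarrow> position_wins G t k {} {} \<Longrightarrow> k \<ge> 1"
  by (cases k) (auto simp: position_wins_def S_wins_0 not_has_dominating_subset_empty split: if_splits)

lemma affine_gamma_le:
  assumes fin: "finite (pverts H)" and ne: "pverts H \<noteq> {}" and b: "b \<ge> 1"
    and "\<And>c. c \<ge> 1 \<Longrightarrow> \<not> position_wins H True (c - 1) {} {} \<Longrightarrow> a + b * c \<le> K"
  shows "enat a + enat b * gamma_MB H \<le> enat K"
proof (cases "gamma_MB H")
  case (enat c)
  have "c \<ge> 1"
    using mb_number_attained[OF fin enat] position_wins_empty_pos[OF ne] by blast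
  moreover have "\<not> position_wins H True (c - 1) {} {}"
  proof
    assume "position_wins H True (c - 1) {} {}"
    then have "gamma_MB H \<le> enat (c - 1)" by (intro mb_number_le fin) simp
    then show False using enat \<open>c \<ge> 1\<close> by simp
  qed
  ultimately show ?thesis using assms(4)[of c] by (simp add: enat)
next
  case infinity
  \<comment> \<open>When no number of moves suffices on \<open>H\<close>, the choice
    \<open>c = Suc K\<close> gives a bound above \<open>K\<close>, a contradiction as
    \<open>b \<ge> 1\<close>.\<close>
  have "\<not> position_wins H True (Suc K - 1) {} {}"
  proof
    assume "position_wins H True (Suc K - 1) {} {}"
    then have "gamma_MB H \<le> enat K" by (intro mb_number_le fin) simp
    then show False by (simp add: infinity)
  qed
  then have "a + b * Suc K \<le> K" using assms(4)[of "Suc K"] by simp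
  moreover have "1 * Suc K \<le> b * Suc K" using b by (rule mult_le_mono1)
  ultimately show ?thesis by simp
qed

text \<open>A finite value is attained; an infinite one makes the right side \<infinity>, where
  \<open>b \<ge> 1\<close> matters since \<open>0 * \<infinity> = 0\<close> in
  \<open>enat\<close>.\<close>

lemma le_affine_gamma':
  assumes fin: "finite (pverts H)" and ne: "pverts H \<noteq> {}" and b: "b \<ge> 1"
    and "\<And>h. h \<ge> 1 \<Longrightarrow> position_wins H False h {} {} \<Longrightarrow> z \<le> enat (a + b * h)"
  shows "z \<le> enat a + enat b * gamma_MB' H"
proof (cases "gamma_MB' H")
  case (enat h)
  have "position_wins H False h {} {}" using mb_number_attained[OF fin enat] by simp
  then show ?thesis using assms(4)[of h] position_wins_empty_pos[OF ne] by (simp add: enat)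
next
  case infinity
  then show ?thesis using b by (simp add: imult_is_infinity)
qed

theorem theorem3p2:
  fixes G :: "'a pair_pre_digraph" and H :: "'b pair_pre_digraph" and n :: nat
  assumes "pair_graph H" and "pverts H \<noteq> {}" and "outcome_D H"
    and "pair_graph G" and "Digraph_Component.connected (with_proj G)"
    and "n = card (pverts G)" and "n \<ge> 2"
  shows "enat (nat \<lceil>real n / 2\<rceil>) + enat (nat \<lfloor>real n / 2\<rfloor>) * gamma_MB H \<le> gamma_MB (G \<odot> H)
       \<and> gamma_MB (G \<odot> H) \<le> enat (nat \<lceil>real n / 2\<rceil>) + enat (nat \<lfloor>real n / 2\<rfloor>) * gamma_MB' H
       \<and> enat (nat \<lfloor>real n / 2\<rfloor>) + enat (nat \<lceil>real n / 2\<rceil>) * gamma_MB H \<le> gamma_MB' (G \<odot> H)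
       \<and> gamma_MB' (G \<odot> H) \<le> enat (nat \<lfloor>real n / 2\<rfloor>) + enat (nat \<lceil>real n / 2\<rceil>) * gamma_MB' H"
proof -
  interpret G: pair_graph G by fact
  interpret H: pair_graph H by fact
  interpret GH: pair_graph "G \<odot> H" by (intro pair_graph_corona assms)
  interpret switched_boards "pverts G" "pverts H" "has_dominating_subset H"
    by unfold_locales (rule G.pair_finite_verts)
  have goal: "has_dominating_subset (G \<odot> H) = goal"
    using assms(2) by (intro ext) (simp add: has_dominating_subset_corona goal_def)
  have verts: "pverts (G \<odot> H) = vertices" by (simp add: corona_def vertices_def)
  note fin = GH.pair_finite_verts H.pair_finite_verts
  have floor: "nat \<lfloor>real n / 2\<rfloor> = n div 2" by linarith
  have ceiling: "nat \<lceil>real n / 2\<rceil> = (n + 1) div 2" by linarith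
  \<comment> \<open>From \<open>n \<ge> 2\<close> both coefficients are positive, as the infinite
    cases require.\<close>
  have n: "n div 2 \<ge> 1" "(n + 1) div 2 \<ge> 1" "pverts G \<noteq> {}" using assms(6,7) by auto
  note pw = position_wins_def goal verts
  show ?thesis
    unfolding floor ceiling
  proof (intro conjI)
    show "enat ((n + 1) div 2) + enat (n div 2) * gamma_MB H \<le> gamma_MB (G \<odot> H)"
      using D_wins_lower n assms(2,6)
      by (intro le_mb_number affine_gamma_le fin) (auto simp: pw)
    show "gamma_MB (G \<odot> H) \<le> enat ((n + 1) div 2) + enat (n div 2) * gamma_MB' H"
      using D_wins_upper n assms(2,6)
      by (intro le_affine_gamma' mb_number_le fin) (auto simp: pw)
    show "enat (n div 2) + enat ((n + 1) div 2) * gamma_MB H \<le> gamma_MB' (G \<odot> H)"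
      using S_wins_lower n assms(2,6)
      by (intro le_mb_number affine_gamma_le fin) (auto simp: pw)
    show "gamma_MB' (G \<odot> H) \<le> enat (n div 2) + enat ((n + 1) div 2) * gamma_MB' H"
      using S_wins_upper n assms(2,6)
      by (intro le_affine_gamma' mb_number_le fin) (auto simp: pw)
  qed
qed

end
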